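(* Let $X$ be a path connected topological space, $x\in X$, let $H$ be a subset of $\pi_1(X,x)$ and let $K$ be a subgroup of $\pi_1(X,x)$ containing $\pi_1^{qs}(X,x)$ (or containing $\pi_1^{sp}(X,x)$). Then $H\subseteq K$ if and only if $\pi_H^{qs}(X,x)\subseteq K$. In particular, $\pi_K^{qs}(X,x)=K$.
   Context: All spaces are assumed path connected. $I=[0,1]$, $\dot I=\{0,1\}$; $\simeq$ rel $\dot I$ denotes homotopy of paths relative to endpoints, and $[f]$ is the homotopy class of a path $f$ rel $\dot I$. $*$ is concatenation of paths, $g^{-1}$ is the reverse path, $c_x$ is the constant path at $x$. Closeness: let $f,g:I\to X$ be paths with $f(0)=g(0)$ and $f(1)=g(1)$. We say $f$ is homotopically close to $g$ rel $\dot I$ (written $f\xrightarrow{close} g$ rel $\dot I$) if for every partition $0=t_0<t_1<\cdots<t_n=1$ and every sequence of open sets $U_1,\ldots,U_n$ of $X$ with $g([t_{i-1},t_i])\subset U_i$ for all $i$, there is a path $\gamma$ with $\gamma([t_{i-1},t_i])\subset U_i$ for $1\le i\le n$, $\gamma(t_i)=g(t_i)$ for $0\le i\le n$, and $\gamma\simeq f$ rel $\dot I$. For a subset $H\subseteq\pi_1(X,x)$, $\pi_H^{qs}(X,x)=\{[f]\in\pi_1(X,x) : f\xrightarrow{close} h \text{ rel } \dot I \text{ for some loop } h \text{ at } x \text{ with } [h]\in H\}$. For $H=\{[c_x]\}$ the trivial subgroup, write $\pi_1^{qs}(X,x)$. Spanier group: for an open cover $\mathcal U$ of $X$, $\pi(\mathcal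 U,x)\le\pi_1(X,x)$ is the subgroup of all homotopy classes having representatives of the form $\prod_{j=1}^n u_j*v_j*u_j^{-1}$, where each $u_j$ is a path starting at $x$ and each $v_j$ is a loop based at $u_j(1)$ inside some member of $\mathcal U$. The (unbased) Spanier group $\pi_1^{sp}(X,x)$ is the inverse limit of the groups $\pi(\mathcal U,x)$ over all open covers directed by refinement (with inclusions as bonding maps), i.e. the intersection $\bigcap_{\mathcal U}\pi(\mathcal U,x)$. *)

theory Defs
  imports "HOL-Analysis.Analysis" "HOL-Algebra.Coset"
begin

text \<open>
  A space is a set \<open>S\<close> in a type of class \<open>topological_space\<close>, with the subspace topology
  \<open>top_of_set S\<close>. Paths are functions \<open>real \<Rightarrow> 'a\<close> of which only the restriction to
  \<open>{0..1}\<close> matters; paths that agree on \<open>{0..1}\<close> are identified by \<open>homotopic_paths\<close>. The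
  constant path is written \<open>\<lambda>_. x\<close>, since \<open>linepath x x\<close> requires a normed vector space.
\<close>

definition loops_at :: "'a::topological_space set \<Rightarrow> 'a \<Rightarrow> (real \<Rightarrow> 'a) set" where
  "loops_at S x = {p. path p \<and> path_image p \<subseteq> S \<and> pathstart p = x \<and> pathfinish p = x}"

definition path_class :: "'a::topological_space set \<Rightarrow> (real \<Rightarrow> 'a) \<Rightarrow> (real \<Rightarrow> 'a) set" where
  "path_class S p = {q. homotopic_paths S p q}"

definition fundamental_group ::
    "'a::topological_space set \<Rightarrow> 'a \<Rightarrow> (real \<Rightarrow> 'a) set monoid" where
  "fundamental_group S x =
     \<lparr>carrier = path_class S ` loops_at S x,
      monoid.mult = (\<lambda>A B. \<Union>p\<in>A. \<Union>q\<in>B. path_class S (p +++ q)),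
      one = path_class S (\<lambda>_. x)\<rparr>"

definition homotopically_close ::
    "'a::topological_space set \<Rightarrow> (real \<Rightarrow> 'a) \<Rightarrow> (real \<Rightarrow> 'a) \<Rightarrow> bool" where
  "homotopically_close S f g \<longleftrightarrow>
     path f \<and> path_image f \<subseteq> S \<and> path g \<and> path_image g \<subseteq> S \<and>
     pathstart f = pathstart g \<and> pathfinish f = pathfinish g \<and>
     (\<forall>(n::nat) (t::nat \<Rightarrow> real) (U::nat \<Rightarrow> 'a set).
        t 0 = 0 \<and> t n = 1 \<and> (\<forall>i\<in>{1..n}. t (i - 1) < t i) \<and>
        (\<forall>i\<in>{1..n}. openin (top_of_set S) (U i) \<and> g ` {t (i - 1)..t i} \<subseteq> U i) \<longrightarrow>
        (\<exists>\<gamma>. path \<gamma> \<and> path_image \<gamma> \<subseteq> S \<and>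
             (\<forall>i\<in>{1..n}. \<gamma> ` {t (i - 1)..t i} \<subseteq> U i) \<and>
             (\<forall>i\<in>{0..n}. \<gamma> (t i) = g (t i)) \<and>
             homotopic_paths S \<gamma> f))"

definition qs_closure ::
    "'a::topological_space set \<Rightarrow> 'a \<Rightarrow> (real \<Rightarrow> 'a) set set \<Rightarrow> (real \<Rightarrow> 'a) set set" where
  "qs_closure S x H =
     {path_class S f | f. f \<in> loops_at S x \<and>
        (\<exists>h\<in>loops_at S x. path_class S h \<in> H \<and> homotopically_close S f h)}"

definition qs_group :: "'a::topological_space set \<Rightarrow> 'a \<Rightarrow> (real \<Rightarrow> 'a) set set" where
  "qs_group S x = qs_closure S x {path_class S (\<lambda>_. x)}"

definition open_cover :: "'a::topological_space set \<Rightarrow> 'a set set \<Rightarrow> bool" where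
  "open_cover S \<U> \<longleftrightarrow> (\<forall>U\<in>\<U>. openin (top_of_set S) U) \<and> \<Union>\<U> = S"

text \<open>
  The product of the conjugates \<open>u +++ v +++ reversepath u\<close>, bracketed to the right and ending
  in a constant path. Neither choice affects the homotopy class.
\<close>

fun conjugate_product ::
    "'a::topological_space \<Rightarrow> ((real \<Rightarrow> 'a) \<times> (real \<Rightarrow> 'a)) list \<Rightarrow> real \<Rightarrow> 'a" where
  "conjugate_product x [] = (\<lambda>_. x)"
| "conjugate_product x ((u, v) # ps) = (u +++ v +++ reversepath u) +++ conjugate_product x ps"

definition spanier_cover_group ::
    "'a::topological_space set \<Rightarrow> 'a set set \<Rightarrow> 'a \<Rightarrow> (real \<Rightarrow> 'a) set set" where
  "spanier_cover_group S \<U> x =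
     {path_class S (conjugate_product x ps) | ps.
        \<forall>(u, v)\<in>set ps. path u \<and> path_image u \<subseteq> S \<and> pathstart u = x \<and>
          (\<exists>U\<in>\<U>. v \<in> loops_at U (pathfinish u))}"

definition spanier_group :: "'a::topological_space set \<Rightarrow> 'a \<Rightarrow> (real \<Rightarrow> 'a) set set" where
  "spanier_group S x = \<Inter>{spanier_cover_group S \<U> x | \<U>. open_cover S \<U>}"

lemma homotopic_paths_const_right:
  fixes p :: "real \<Rightarrow> 'a::topological_space"
  assumes p: "path p" "path_image p \<subseteq> S" and x: "x = pathfinish p"
  shows "homotopic_paths S (p +++ (\<lambda>_. x)) p"
proof -
  let ?f = "\<lambda>t::real. min (2 * t) 1"
  have "homotopic_paths S p (p +++ (\<lambda>_. x))"
    by (rule homotopic_paths_reparametrize[OF p, where f = ?f])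
       (intro continuous_intros, auto simp: joinpaths_def x pathfinish_def min_def)
  then show ?thesis
    by (rule homotopic_paths_sym)
qed

lemma homotopic_paths_const_left:
  fixes p :: "real \<Rightarrow> 'a::topological_space"
  assumes p: "path p" "path_image p \<subseteq> S" and x: "x = pathstart p"
  shows "homotopic_paths S ((\<lambda>_. x) +++ p) p"
proof -
  let ?f = "\<lambda>t::real. max (2 * t - 1) 0"
  have "homotopic_paths S p ((\<lambda>_. x) +++ p)"
    by (rule homotopic_paths_reparametrize[OF p, where f = ?f])
       (intro continuous_intros, auto simp: joinpaths_def x pathstart_def max_def)
  then show ?thesis
    by (rule homotopic_paths_sym)
qed

lemma homotopic_paths_reverse_right:
  fixes p :: "real \<Rightarrow> 'a::topological_space"
  assumes p: "path p" "path_image p \<subseteq> S" and x: "x = pathstart p"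
  shows "homotopic_paths S (p +++ reversepath p) (\<lambda>_. x)"
proof -
  let ?f = "\<lambda>t::real. min (2 * t) (2 - 2 * t)"
  let ?h = "\<lambda>y::real \<times> real. p (fst y * ?f (snd y))"
  have f: "?f t \<in> {0..1}" if "t \<in> {0..1}" for t
    using that by (auto simp: min_def)
  have r: "(\<lambda>y::real \<times> real. fst y * ?f (snd y)) ` ({0..1} \<times> {0..1}) \<subseteq> {0..1}"
  proof clarify
    fix a b :: real
    assume "a \<in> {0..1}" "b \<in> {0..1}"
    then show "fst (a, b) * ?f (snd (a, b)) \<in> {0..1}"
      using f[of b] mult_mono[of a 1 "?f b" 1] by auto
  qed
  have c: "continuous_on ({0..1} \<times> {0..1}) ?h"
    by (rule continuous_on_compose2[OF _ _ r])
       (use p in \<open>auto simp: path_def intro!: continuous_intros\<close>)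
  have "homotopic_paths S (\<lambda>_. x) (p +++ reversepath p)"
    unfolding homotopic_paths
  proof (intro exI[of _ ?h] conjI ballI)
    show "?h \<in> {0..1} \<times> {0..1} \<rightarrow> S"
    proof
      fix y :: "real \<times> real"
      assume "y \<in> {0..1} \<times> {0..1}"
      then have "fst y * ?f (snd y) \<in> {0..1}"
        using r by blast
      then show "?h y \<in> S"
        using p(2) unfolding path_image_def by blast
    qed
    show "?h (1, t) = (p +++ reversepath p) t" if "t \<in> {0..1}" for t
      by (auto simp: joinpaths_def reversepath_def min_def algebra_simps)
  qed (use c in \<open>auto simp: x pathstart_def pathfinish_def\<close>)
  then show ?thesis
    by (rule homotopic_paths_sym)
qed

lemma path_class_eqI:
  assumes "homotopic_paths S p q"
  shows "path_class S p = path_class S q"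
proof -
  have "homotopic_paths S p r \<longleftrightarrow> homotopic_paths S q r" for r
    using homotopic_paths_trans[OF assms] homotopic_paths_trans[OF homotopic_paths_sym[OF assms]]
    by blast
  then show ?thesis
    by (simp add: path_class_def)
qed

lemma path_class_eq_iff:
  assumes "path p" "path_image p \<subseteq> S"
  shows "path_class S p = path_class S q \<longleftrightarrow> homotopic_paths S p q"
proof
  assume eq: "path_class S p = path_class S q"
  have "p \<in> path_class S p"
    using assms by (simp add: path_class_def)
  then have "p \<in> path_class S q"
    by (simp only: eq)
  then show "homotopic_paths S p q"
    by (simp add: path_class_def homotopic_paths_sym)
qed (rule path_class_eqI)

lemma loops_at_const: "x \<in> S \<Longrightarrow> (\<lambda>_. x) \<in> loops_at S x"
  by (auto simp: loops_at_def path_def path_image_def pathstart_def pathfinish_def)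

lemma loops_at_join: "p \<in> loops_at S x \<Longrightarrow> q \<in> loops_at S x \<Longrightarrow> p +++ q \<in> loops_at S x"
  by (auto simp: loops_at_def path_image_join)

lemma loops_at_reverse: "p \<in> loops_at S x \<Longrightarrow> reversepath p \<in> loops_at S x"
  by (auto simp: loops_at_def)

lemma mult_path_class:
  assumes "p \<in> loops_at S x" "q \<in> loops_at S x"
  shows "path_class S p \<otimes>\<^bsub>fundamental_group S x\<^esub> path_class S q = path_class S (p +++ q)"
proof -
  have *: "path_class S (p' +++ q') = path_class S (p +++ q)"
    if "p' \<in> path_class S p" "q' \<in> path_class S q" for p' q'
  proof -
    have "homotopic_paths S (p +++ q) (p' +++ q')"
      using that assms by (intro homotopic_paths_join) (auto simp: path_class_def loops_at_def)
    then show ?thesis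
      by (rule path_class_eqI[symmetric])
  qed
  have "p \<in> path_class S p" "q \<in> path_class S q"
    using assms by (simp_all add: path_class_def loops_at_def)
  then have "(\<Union>p'\<in>path_class S p. \<Union>q'\<in>path_class S q. path_class S (p' +++ q')) =
      path_class S (p +++ q)"
    using * by blast
  then show ?thesis
    by (simp add: fundamental_group_def)
qed

lemma group_fundamental_group:
  assumes "x \<in> S"
  shows "group (fundamental_group S x)"
proof (rule groupI)
  let ?G = "fundamental_group S x"
  have carr: "carrier ?G = path_class S ` loops_at S x"
    and one: "\<one>\<^bsub>?G\<^esub> = path_class S (\<lambda>_. x)"
    by (auto simp: fundamental_group_def)
  show "a \<otimes>\<^bsub>?G\<^esub> b \<in> carrier ?G" if "a \<in> carrier ?G" "b \<in> carrier ?G" for a b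
    using that by (auto simp: carr mult_path_class loops_at_join)
  show "\<one>\<^bsub>?G\<^esub> \<in> carrier ?G"
    by (simp add: carr one loops_at_const assms)
  show "a \<otimes>\<^bsub>?G\<^esub> b \<otimes>\<^bsub>?G\<^esub> c = a \<otimes>\<^bsub>?G\<^esub> (b \<otimes>\<^bsub>?G\<^esub> c)"
    if abc: "a \<in> carrier ?G" "b \<in> carrier ?G" "c \<in> carrier ?G" for a b c
  proof -
    obtain p q r where pqr: "p \<in> loops_at S x" "q \<in> loops_at S x" "r \<in> loops_at S x"
      and eq: "a = path_class S p" "b = path_class S q" "c = path_class S r"
      using abc by (auto simp: carr)
    have "homotopic_paths S (p +++ q +++ r) ((p +++ q) +++ r)"
      using pqr by (intro homotopic_paths_assoc) (auto simp: loops_at_def)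
    then have "path_class S (p +++ q +++ r) = path_class S ((p +++ q) +++ r)"
      by (rule path_class_eqI)
    with pqr show ?thesis
      by (simp add: eq mult_path_class loops_at_join)
  qed
  fix a
  assume "a \<in> carrier ?G"
  then obtain p where p: "p \<in> loops_at S x" and a: "a = path_class S p"
    by (auto simp: carr)
  then have pp: "path p" "path_image p \<subseteq> S" "pathstart p = x" "pathfinish p = x"
    by (auto simp: loops_at_def)
  have "homotopic_paths S ((\<lambda>_. x) +++ p) p"
    using pp by (intro homotopic_paths_const_left) auto
  then have "path_class S ((\<lambda>_. x) +++ p) = path_class S p"
    by (rule path_class_eqI)
  then show "\<one>\<^bsub>?G\<^esub> \<otimes>\<^bsub>?G\<^esub> a = a"
    by (simp add: one a mult_path_class[OF loops_at_const[OF assms] p])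
  have "homotopic_paths S (reversepath p +++ p) (\<lambda>_. x)"
    using homotopic_paths_reverse_right[of "reversepath p" S x] pp by simp
  then have "path_class S (reversepath p +++ p) = path_class S (\<lambda>_. x)"
    by (rule path_class_eqI)
  then show "\<exists>b\<in>carrier ?G. b \<otimes>\<^bsub>?G\<^esub> a = \<one>\<^bsub>?G\<^esub>"
    using p by (intro bexI[of _ "path_class S (reversepath p)"])
      (auto simp: carr one a mult_path_class loops_at_reverse)
qed

end

theory Submission
  imports Defs
begin

text \<open>
  Multiplying by a fixed loop is compatible with closeness. So if a loop \<open>f\<close> is close to a loop
  \<open>h\<close>, then \<open>f * h\<^sup>-\<^sup>1\<close> is close to \<open>h * h\<^sup>-\<^sup>1\<close>, which is null-homotopic, and hence
  \<open>[f] [h]\<^sup>-\<^sup>1 \<in> \<pi>\<^sub>1\<^sup>q\<^sup>s\<close>. A subgroup that contains \<open>\<pi>\<^sub>1\<^sup>q\<^sup>s\<close> and \<open>[h]\<close> therefore contains \<open>[f]\<close>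
  (\<open>homotopically_close_imp_mult_inv_in_qs_group\<close>). The other inclusions follow from
  reflexivity of closeness.

  It remains that \<open>\<pi>\<^sub>1\<^sup>q\<^sup>s \<subseteq> \<pi>\<^sub>1\<^sup>s\<^sup>p\<close> (\<open>qs_group_subset_spanier_group\<close>), so that the hypothesis on
  the Spanier group reduces to the one on \<open>\<pi>\<^sub>1\<^sup>q\<^sup>s\<close>. Given an open cover and a loop \<open>f\<close> close to a
  null-homotopic loop \<open>h\<close>, cut \<open>h\<close> into pieces that each lie in a member of the cover. Closeness
  supplies a loop \<open>\<gamma> \<simeq> f\<close> that has the same cut points and whose pieces lie in the same members.
  Now \<open>h\<close> turns into \<open>\<gamma>\<close> by exchanging one piece after the other, and each exchange
  multiplies the class by a conjugate of a loop (new piece, then old piece backwards) inside one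
  member of the cover. Thus \<open>[f] = [\<gamma>]\<close> is a product of such conjugates times \<open>[h] = 1\<close>.
\<close>

section \<open>Closeness of paths\<close>

lemma homotopically_close_refl:
  assumes "path f" "path_image f \<subseteq> S"
  shows "homotopically_close S f f"
  unfolding homotopically_close_def
proof (intro conjI allI impI)
  fix n :: nat and t :: "nat \<Rightarrow> real" and U :: "nat \<Rightarrow> 'a set"
  assume "t 0 = 0 \<and> t n = 1 \<and> (\<forall>i\<in>{1..n}. t (i - 1) < t i) \<and>
    (\<forall>i\<in>{1..n}. openin (top_of_set S) (U i) \<and> f ` {t (i - 1)..t i} \<subseteq> U i)"
  then show "\<exists>\<gamma>. path \<gamma> \<and> path_image \<gamma> \<subseteq> S \<and> (\<forall>i\<in>{1..n}. \<gamma> ` {t (i - 1)..t i} \<subseteq> U i) \<and>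
    (\<forall>i\<in>{0..n}. \<gamma> (t i) = f (t i)) \<and> homotopic_paths S \<gamma> f"
    using assms by (intro exI[of _ f]) simp
qed (use assms in simp_all)

lemma homotopically_close_approximation:
  fixes n :: nat and t :: "nat \<Rightarrow> real"
  assumes "homotopically_close S f g" and "t 0 = 0" "t n = 1"
    and "\<forall>i\<in>{1..n}. t (i - 1) < t i"
    and "\<forall>i\<in>{1..n}. openin (top_of_set S) (U i) \<and> g ` {t (i - 1)..t i} \<subseteq> U i"
  obtains \<gamma> where "path \<gamma>" "path_image \<gamma> \<subseteq> S" "\<forall>i\<in>{1..n}. \<gamma> ` {t (i - 1)..t i} \<subseteq> U i"
    and "\<forall>i\<in>{0..n}. \<gamma> (t i) = g (t i)" "homotopic_paths S \<gamma> f"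
proof -
  have "\<forall>(n::nat) (t::nat \<Rightarrow> real) U. t 0 = 0 \<and> t n = 1 \<and> (\<forall>i\<in>{1..n}. t (i - 1) < t i) \<and>
      (\<forall>i\<in>{1..n}. openin (top_of_set S) (U i) \<and> g ` {t (i - 1)..t i} \<subseteq> U i) \<longrightarrow>
      (\<exists>\<gamma>. path \<gamma> \<and> path_image \<gamma> \<subseteq> S \<and> (\<forall>i\<in>{1..n}. \<gamma> ` {t (i - 1)..t i} \<subseteq> U i) \<and>
        (\<forall>i\<in>{0..n}. \<gamma> (t i) = g (t i)) \<and> homotopic_paths S \<gamma> f)"
    using assms(1) unfolding homotopically_close_def by (elim conjE)
  from this[rule_format, of t n U] assms(2-) that show ?thesis
    by auto
qed

text \<open>
  A partition of the unit interval for \<open>h +++ r\<close> is cut off at \<open>1/2\<close> and rescaled to one for \<open>h\<close>;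
  an approximation of \<open>h\<close> followed by \<open>r\<close> itself is then an approximation of \<open>h +++ r\<close>.
\<close>

lemma homotopically_close_join:
  assumes close: "homotopically_close S f h"
    and r: "path r" "path_image r \<subseteq> S" "pathfinish f = pathstart r"
  shows "homotopically_close S (f +++ r) (h +++ r)"
  unfolding homotopically_close_def
proof (intro conjI allI impI)
  have fh: "path f" "path_image f \<subseteq> S" "path h" "path_image h \<subseteq> S"
    "pathstart f = pathstart h" "pathfinish f = pathfinish h"
    using close by (auto simp: homotopically_close_def)
  show "path (f +++ r)" "path_image (f +++ r) \<subseteq> S" "path (h +++ r)" "path_image (h +++ r) \<subseteq> S"
    "pathstart (f +++ r) = pathstart (h +++ r)" "pathfinish (f +++ r) = pathfinish (h +++ r)"
    using fh r by (auto simp: path_image_join)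
  fix n :: nat and t :: "nat \<Rightarrow> real" and U :: "nat \<Rightarrow> 'a set"
  assume *: "t 0 = 0 \<and> t n = 1 \<and> (\<forall>i\<in>{1..n}. t (i - 1) < t i) \<and>
    (\<forall>i\<in>{1..n}. openin (top_of_set S) (U i) \<and> (h +++ r) ` {t (i - 1)..t i} \<subseteq> U i)"
  then have t0: "t 0 = 0" and tn: "t n = 1"
    and tless: "\<And>i. i \<in> {1..n} \<Longrightarrow> t (i - 1) < t i"
    and U: "\<And>i. i \<in> {1..n} \<Longrightarrow> openin (top_of_set S) (U i)"
    and hrU: "\<And>i y. i \<in> {1..n} \<Longrightarrow> y \<in> {t (i - 1)..t i} \<Longrightarrow> (h +++ r) y \<in> U i"
    by blast+
  have mono: "t i \<le> t j" if "i \<le> j" "j \<le> n" for i j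
    using that
  proof (induction j rule: dec_induct)
    case (step j)
    then show ?case using tless[of "Suc j"] by simp
  qed simp
  define m where "m = (LEAST i. 1/2 \<le> t i)"
  have mn: "m \<le> n" and tm: "1/2 \<le> t m"
    using Least_le[of "\<lambda>i. 1/2 \<le> t i" n] LeastI[of "\<lambda>i. 1/2 \<le> t i" n] tn by (auto simp: m_def)
  have tlow: "t i < 1/2" if "i < m" for i
    using not_less_Least[of i "\<lambda>i. 1/2 \<le> t i"] that by (simp add: m_def)
  define s where "s i = min (2 * t i) 1" for i
  have s0: "s 0 = 0" and sm: "s m = 1"
    using t0 tm by (auto simp: s_def)
  have sless: "s (i - 1) < s i" if "i \<in> {1..m}" for i
  proof -
    have "i - 1 < m" "i \<in> {1..n}" using that mn by auto
    then show ?thesis using tless[of i] tlow[of "i - 1"] by (simp add: s_def min_def)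
  qed
  have hU: "h ` {s (i - 1)..s i} \<subseteq> U i" if i: "i \<in> {1..m}" for i
  proof clarify
    fix y assume y: "y \<in> {s (i - 1)..s i}"
    have "i - 1 < m"
      using i by auto
    then have "t (i - 1) < 1/2"
      by (rule tlow)
    then have "y / 2 \<in> {t (i - 1)..t i}" "y \<le> 1"
      using y by (auto simp: s_def)
    then show "h y \<in> U i"
      using hrU[of i "y / 2"] i mn by (auto simp: joinpaths_def)
  qed
  obtain \<gamma> where \<gamma>: "path \<gamma>" "path_image \<gamma> \<subseteq> S"
    and \<gamma>U: "\<And>i. i \<in> {1..m} \<Longrightarrow> \<gamma> ` {s (i - 1)..s i} \<subseteq> U i"
    and \<gamma>s: "\<And>i. i \<in> {0..m} \<Longrightarrow> \<gamma> (s i) = h (s i)"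
    and \<gamma>f: "homotopic_paths S \<gamma> f"
  proof -
    have "\<forall>i\<in>{1..m}. openin (top_of_set S) (U i) \<and> h ` {s (i - 1)..s i} \<subseteq> U i"
      using U hU mn by simp
    moreover have "\<forall>i\<in>{1..m}. s (i - 1) < s i"
      using sless by blast
    ultimately obtain \<gamma> where "path \<gamma>" "path_image \<gamma> \<subseteq> S" "homotopic_paths S \<gamma> f"
      and \<gamma>: "\<forall>i\<in>{1..m}. \<gamma> ` {s (i - 1)..s i} \<subseteq> U i" "\<forall>i\<in>{0..m}. \<gamma> (s i) = h (s i)"
      using homotopically_close_approximation[OF close s0 sm] by metis
    then show ?thesis
      by (intro that) (use \<gamma> in blast)+
  qed
  have \<gamma>1: "\<gamma> 1 = h 1"
    using \<gamma>s[of m] sm by simp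
  have \<gamma>r: "pathfinish \<gamma> = pathstart r"
    using \<gamma>1 fh r by (simp add: pathfinish_def)
  show "\<exists>\<gamma>. path \<gamma> \<and> path_image \<gamma> \<subseteq> S \<and> (\<forall>i\<in>{1..n}. \<gamma> ` {t (i - 1)..t i} \<subseteq> U i) \<and>
    (\<forall>i\<in>{0..n}. \<gamma> (t i) = (h +++ r) (t i)) \<and> homotopic_paths S \<gamma> (f +++ r)"
  proof (intro exI conjI ballI)
    show "path (\<gamma> +++ r)" "path_image (\<gamma> +++ r) \<subseteq> S"
      using \<gamma> r \<gamma>r by (auto simp: path_image_join)
    show "homotopic_paths S (\<gamma> +++ r) (f +++ r)"
      using \<gamma>f \<gamma>r r by (intro homotopic_paths_join) auto
    show "(\<gamma> +++ r) (t i) = (h +++ r) (t i)" if "i \<in> {0..n}" for i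
    proof (cases "t i \<le> 1/2")
      case True
      have "\<gamma> (2 * t i) = h (2 * t i)"
      proof (cases "i \<le> m")
        case le: True
        then show ?thesis using \<gamma>s[of i] True by (simp add: s_def)
      next
        case False
        then have "t m \<le> t i" using mono[of m i] that by simp
        then have "2 * t i = 1" using tm True by simp
        then show ?thesis using \<gamma>1 by simp
      qed
      then show ?thesis by (simp add: joinpaths_def)
    qed (simp add: joinpaths_def)
    show "(\<gamma> +++ r) ` {t (i - 1)..t i} \<subseteq> U i" if i: "i \<in> {1..n}" for i
    proof clarify
      fix y assume y: "y \<in> {t (i - 1)..t i}"
      show "(\<gamma> +++ r) y \<in> U i"
      proof (cases "y \<le> 1/2 \<and> i \<le> m")
        case True
        then have "2 * y \<in> {s (i - 1)..s i}"
          using y by (auto simp: s_def)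
        then show ?thesis
          using \<gamma>U[of i] True i by (auto simp: joinpaths_def)
      next
        \<comment> \<open>beyond the cut-off the two concatenations agree at \<open>y\<close>, either because \<open>y > 1/2\<close>
          or because \<open>y = 1/2\<close> is the left end of its subinterval\<close>
        case False
        have "(\<gamma> +++ r) y = (h +++ r) y"
        proof (cases "y \<le> 1/2")
          case True
          then have "t m \<le> t (i - 1)" using mono[of m "i - 1"] False i by simp
          then have "2 * y = 1" using tm True y by simp
          then show ?thesis using \<gamma>1 by (simp add: joinpaths_def)
        qed (simp add: joinpaths_def)
        then show ?thesis using hrU[OF i y] by simp
      qed
    qed
  qed
qed

text \<open>
  The set \<open>qs_group S x\<close> admits every null-homotopic loop as the limit, not only the constant
  loop; this is why closeness to \<open>h +++ reversepath h\<close> suffices.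
\<close>

lemma homotopically_close_imp_mult_inv_in_qs_group:
  assumes f: "f \<in> loops_at S x" and h: "h \<in> loops_at S x"
    and close: "homotopically_close S f h"
  shows "path_class S (f +++ reversepath h) \<in> qs_group S x"
proof -
  have "homotopically_close S (f +++ reversepath h) (h +++ reversepath h)"
    using f h by (intro homotopically_close_join close) (auto simp: loops_at_def)
  moreover have "homotopic_paths S (h +++ reversepath h) (\<lambda>_. x)"
    using h by (intro homotopic_paths_reverse_right) (auto simp: loops_at_def)
  ultimately show ?thesis
    unfolding qs_group_def qs_closure_def
    using loops_at_join[OF f loops_at_reverse[OF h]] loops_at_join[OF h loops_at_reverse[OF h]]
      path_class_eqI by blast
qed

lemma subset_qs_closure:
  assumes "H \<subseteq> carrier (fundamental_group S x)"
  shows "H \<subseteq> qs_closure S x H"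
proof
  fix a assume a: "a \<in> H"
  then obtain h where h: "h \<in> loops_at S x" "a = path_class S h"
    using assms by (auto simp: fundamental_group_def)
  then have "homotopically_close S h h"
    by (intro homotopically_close_refl) (auto simp: loops_at_def)
  with h a show "a \<in> qs_closure S x H"
    unfolding qs_closure_def by blast
qed

section \<open>Exchanging a piece of a path\<close>

lemma homotopic_paths_cancel_left:
  assumes "path w" "path_image w \<subseteq> S" "path r" "path_image r \<subseteq> S" "pathfinish w = pathstart r"
  shows "homotopic_paths S (reversepath w +++ (w +++ r)) r"
proof -
  have "homotopic_paths S (reversepath w +++ (w +++ r)) ((reversepath w +++ w) +++ r)"
    using assms by (intro homotopic_paths_assoc) auto
  also have "homotopic_paths S \<dots> ((\<lambda>_. pathstart r) +++ r)"
    using assms homotopic_paths_reverse_right[of "reversepath w" S "pathstart r"]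
    by (intro homotopic_paths_join) auto
  also have "homotopic_paths S \<dots> r"
    using assms by (intro homotopic_paths_const_left) auto
  finally show ?thesis .
qed

text \<open>
  In the fundamental groupoid this is \<open>u v r = (u (v w\<^sup>-\<^sup>1) u\<^sup>-\<^sup>1) (u w r)\<close>. The first factor is of the
  kind that generates Spanier groups: the loop \<open>v w\<^sup>-\<^sup>1\<close> lies wherever both pieces do.
\<close>

lemma homotopic_paths_exchange_middle:
  assumes u: "path u" "path_image u \<subseteq> S"
    and v: "path v" "path_image v \<subseteq> S" "pathstart v = pathfinish u"
    and w: "path w" "path_image w \<subseteq> S" "pathstart w = pathfinish u" "pathfinish w = pathfinish v"
    and r: "path r" "path_image r \<subseteq> S" "pathstart r = pathfinish v"
  shows "homotopic_paths S (u +++ (v +++ r))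
    ((u +++ (v +++ reversepath w) +++ reversepath u) +++ (u +++ (w +++ r)))"
proof -
  note assms [simp]
  let ?l = "v +++ reversepath w" and ?u' = "reversepath u" and ?w' = "reversepath w"
  have [simp]: "path_image ?l \<subseteq> S" "path_image (w +++ r) \<subseteq> S" "path_image (u +++ (w +++ r)) \<subseteq> S"
    "path_image (?l +++ ?u') \<subseteq> S" "path_image (?w' +++ (w +++ r)) \<subseteq> S"
    by (auto simp: path_image_join)
  have "homotopic_paths S ((u +++ (?l +++ ?u')) +++ (u +++ (w +++ r)))
      (u +++ ((?l +++ ?u') +++ (u +++ (w +++ r))))"
    by (intro homotopic_paths_sym[OF homotopic_paths_assoc]) auto
  also have "homotopic_paths S \<dots> (u +++ (?l +++ (?u' +++ (u +++ (w +++ r)))))"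
    by (intro homotopic_paths_join homotopic_paths_sym[OF homotopic_paths_assoc]) auto
  also have "homotopic_paths S \<dots> (u +++ (?l +++ (w +++ r)))"
    by (intro homotopic_paths_join homotopic_paths_cancel_left) auto
  also have "homotopic_paths S \<dots> (u +++ (v +++ (?w' +++ (w +++ r))))"
    by (intro homotopic_paths_join homotopic_paths_sym[OF homotopic_paths_assoc]) auto
  also have "homotopic_paths S \<dots> (u +++ (v +++ r))"
    by (intro homotopic_paths_join homotopic_paths_cancel_left) auto
  finally show ?thesis
    by (rule homotopic_paths_sym)
qed

text \<open>
  Restricting a path \<open>g\<close> in a topological space to \<open>[a, b]\<close> means composing it with a segment of
  the real line. The two parametrizations of \<open>[a, c]\<close> are homotopic because \<open>[0, 1]\<close> is convex, and
  \<open>g\<close> carries this homotopy over.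
\<close>

lemma homotopic_paths_join_segments:
  fixes g :: "real \<Rightarrow> 'a::topological_space"
  assumes g: "path g" "path_image g \<subseteq> S" and abc: "0 \<le> a" "a \<le> b" "b \<le> c" "c \<le> 1"
  shows "homotopic_paths S ((g \<circ> linepath a b) +++ (g \<circ> linepath b c)) (g \<circ> linepath a c)"
proof -
  have ab: "linepath p q t \<in> {0..1}" if "t \<in> {0..1}" "p \<in> {0..1}" "q \<in> {0..1}" for p q t :: real
    using that linepath_in_path[of t p q] closed_segment_subset[of p "{0..1}" q] by auto
  have "homotopic_paths {0..1} (linepath a b +++ linepath b c) (linepath a c)"
  proof (rule homotopic_paths_linear)
    fix t :: real assume t: "t \<in> {0..1}"
    have "(linepath a b +++ linepath b c) t \<in> {0..1}"
      using t abc ab[of "2 * t" a b] ab[of "2 * t - 1" b c] by (simp add: joinpaths_def)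
    moreover have "linepath a c t \<in> {0..1}"
      using t abc by (intro ab) auto
    ultimately show "closed_segment ((linepath a b +++ linepath b c) t) (linepath a c t) \<subseteq> {0..1}"
      by (intro closed_segment_subset) auto
  qed auto
  then have "homotopic_paths S (g \<circ> (linepath a b +++ linepath b c)) (g \<circ> linepath a c)"
    using g by (intro homotopic_paths_continuous_image) (auto simp: path_def path_image_def)
  then show ?thesis
    by (simp add: path_compose_join)
qed

text \<open>
  The pieces of \<open>h\<close> are exchanged from left to right. The conjugating path of the \<open>k\<close>-th exchange
  runs along the part of \<open>\<gamma>\<close> that is already in place, so the new conjugate stands to the left of
  the earlier ones.
\<close>

lemma piecewise_close_paths_differ_by_conjugates:
  fixes \<gamma> h :: "real \<Rightarrow> 'a::topological_space"
  assumes \<gamma>: "path \<gamma>" "path_image \<gamma> \<subseteq> S" and h: "path h" "path_image h \<subseteq> S"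
    and t: "t 0 = 0" "t n = 1" "\<And>i. i < n \<Longrightarrow> t i < t (Suc i)"
    and eq: "\<And>i. i \<le> n \<Longrightarrow> \<gamma> (t i) = h (t i)"
    and U: "\<And>i. i < n \<Longrightarrow> \<exists>U\<in>\<U>. \<gamma> ` {t i..t (Suc i)} \<subseteq> U \<and> h ` {t i..t (Suc i)} \<subseteq> U"
    and x: "x = pathstart h"
  shows "\<exists>ps. (\<forall>(u, v)\<in>set ps. path u \<and> path_image u \<subseteq> S \<and> pathstart u = x \<and>
          (\<exists>U\<in>\<U>. v \<in> loops_at U (pathfinish u))) \<and>
      homotopic_paths S \<gamma> (conjugate_product x ps +++ h)"
proof -
  have mono: "t i \<le> t j" if "i \<le> j" "j \<le> n" for i j
    using that
  proof (induction j rule: dec_induct)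
    case (step j)
    then show ?case using t(3)[of j] by simp
  qed simp
  have t01: "0 \<le> t i" "t i \<le> 1" if "i \<le> n" for i
    using mono[of 0 i] mono[of i n] t that by auto
  have seg: "path (g \<circ> linepath a b)" "path_image (g \<circ> linepath a b) = g ` {a..b}"
    "g ` {a..b} \<subseteq> S" "pathstart (g \<circ> linepath a b) = g a" "pathfinish (g \<circ> linepath a b) = g b"
    if "path g" "path_image g \<subseteq> S" "0 \<le> a" "a \<le> b" "b \<le> 1" for g :: "real \<Rightarrow> 'a" and a b
  proof -
    show "path (g \<circ> linepath a b)"
      using that by (intro path_continuous_image)
        (auto simp: closed_segment_eq_real_ivl path_def intro: continuous_on_subset)
    show "path_image (g \<circ> linepath a b) = g ` {a..b}"
      using that by (simp add: path_image_compose closed_segment_eq_real_ivl)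
    show "g ` {a..b} \<subseteq> S"
      using that by (force simp: path_image_def)
  qed (auto simp: pathstart_compose pathfinish_compose)
  \<comment> \<open>the intermediate paths follow \<open>\<gamma>\<close> up to \<open>t k\<close> and \<open>h\<close> from there on\<close>
  have "\<exists>ps. (\<forall>(u, v)\<in>set ps. path u \<and> path_image u \<subseteq> S \<and> pathstart u = x \<and>
          (\<exists>U\<in>\<U>. v \<in> loops_at U (pathfinish u))) \<and>
      homotopic_paths S ((\<gamma> \<circ> linepath 0 (t k)) +++ (h \<circ> linepath (t k) 1))
        (conjugate_product x ps +++ h)" if "k \<le> n" for k
    using that
  proof (induction k)
    case 0
    have "\<gamma> \<circ> linepath 0 0 = (\<lambda>_. x)" "h \<circ> linepath 0 1 = h"
      using eq[of 0] t by (auto simp: fun_eq_iff linepath_def x pathstart_def)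
    moreover have "homotopic_paths S ((\<lambda>_. x) +++ h) h"
      using h by (intro homotopic_paths_const_left) (simp_all add: x)
    then have "homotopic_paths S ((\<lambda>_. x) +++ h) ((\<lambda>_. x) +++ h)"
      using homotopic_paths_sym homotopic_paths_trans by blast
    ultimately show ?case
      by (intro exI[of _ "[]"]) (simp only: t conjugate_product.simps list.set ball_simps)
  next
    case (Suc k)
    then obtain ps where ps: "\<forall>(u, v)\<in>set ps. path u \<and> path_image u \<subseteq> S \<and> pathstart u = x \<and>
          (\<exists>U\<in>\<U>. v \<in> loops_at U (pathfinish u))"
      and IH: "homotopic_paths S ((\<gamma> \<circ> linepath 0 (t k)) +++ (h \<circ> linepath (t k) 1))
        (conjugate_product x ps +++ h)"
      using Suc_leD by blast
    let ?a = "t k" and ?b = "t (Suc k)"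
    let ?u = "\<gamma> \<circ> linepath 0 ?a" and ?v = "\<gamma> \<circ> linepath ?a ?b"
      and ?w = "h \<circ> linepath ?a ?b" and ?r = "h \<circ> linepath ?b 1"
    let ?l = "?v +++ reversepath ?w"
    have ab: "0 \<le> ?a" "?a \<le> ?b" "?b \<le> 1" "?a \<le> 1" "0 \<le> ?b"
      using t01[of k] t01[of "Suc k"] mono[of k "Suc k"] Suc.prems by auto
    have eqs: "\<gamma> ?a = h ?a" "\<gamma> ?b = h ?b"
      using eq Suc.prems by auto
    have \<gamma>0: "\<gamma> 0 = x"
      using eq[of 0] t by (auto simp: x pathstart_def)
    note [simp] = seg[OF \<gamma> order_refl ab(1) ab(4)] seg[OF \<gamma> ab(1-3)] seg[OF h ab(1-3)]
      seg[OF h ab(5) ab(3) order_refl] seg[OF h ab(1) ab(4) order_refl] eqs \<gamma>0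
    have [simp]: "\<gamma> ` {0..?b} \<subseteq> S"
      by (rule seg(3)[OF \<gamma> order_refl ab(5) ab(3)])
    let ?c = "?u +++ ?l +++ reversepath ?u"
    have c: "path ?c" "path_image ?c \<subseteq> S" "pathstart ?c = x" "pathfinish ?c = x"
      by (auto simp: path_image_join)
    have cp: "path (conjugate_product x ps)" "path_image (conjugate_product x ps) \<subseteq> S"
      "pathfinish (conjugate_product x ps) = x" "pathstart (conjugate_product x ps) = x"
    proof -
      have fin: "pathfinish (conjugate_product x qs) = x" for qs
        by (induction qs) (auto simp: pathfinish_def joinpaths_def)
      have p: "path (conjugate_product x ps +++ h)" "path_image (conjugate_product x ps +++ h) \<subseteq> S"
        using IH homotopic_paths_imp_path homotopic_paths_imp_subset by blast+
      show "pathfinish (conjugate_product x ps) = x" by (rule fin)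
      then show "path (conjugate_product x ps)" "path_image (conjugate_product x ps) \<subseteq> S"
        using p by (auto simp: path_image_join x)
      show "pathstart (conjugate_product x ps) = x"
        using homotopic_paths_imp_pathstart[OF IH] by simp
    qed
    have "homotopic_paths S ((\<gamma> \<circ> linepath 0 ?b) +++ ?r) ((?u +++ ?v) +++ ?r)"
      using ab homotopic_paths_sym[OF homotopic_paths_join_segments[OF \<gamma> order_refl ab(1-3)]]
      by (intro homotopic_paths_join) (auto simp: pathfinish_compose)
    also have "homotopic_paths S \<dots> (?u +++ (?v +++ ?r))"
      by (intro homotopic_paths_sym[OF homotopic_paths_assoc]) auto
    also have "homotopic_paths S \<dots> (?c +++ (?u +++ (?w +++ ?r)))"
      by (intro homotopic_paths_exchange_middle) auto
    also have "homotopic_paths S \<dots> (?c +++ (?u +++ (h \<circ> linepath ?a 1)))"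
      using c homotopic_paths_join_segments[OF h ab(1-3) order_refl]
      by (intro homotopic_paths_join) auto
    also have "homotopic_paths S \<dots> (?c +++ (conjugate_product x ps +++ h))"
      using c by (intro homotopic_paths_join[OF _ IH]) auto
    also have "homotopic_paths S \<dots> (conjugate_product x ((?u, ?l) # ps) +++ h)"
      using c cp h by (subst conjugate_product.simps, intro homotopic_paths_assoc) (auto simp: x)
    finally have hom: "homotopic_paths S ((\<gamma> \<circ> linepath 0 ?b) +++ ?r)
      (conjugate_product x ((?u, ?l) # ps) +++ h)" .
    obtain V where V: "V \<in> \<U>" "\<gamma> ` {?a..?b} \<subseteq> V" "h ` {?a..?b} \<subseteq> V"
      using U[of k] Suc.prems by auto
    have "?l \<in> loops_at V (pathfinish ?u)"
      using V unfolding loops_at_def by (auto simp: path_image_join)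
    with V(1) ps show ?case
      by (intro exI[of _ "(?u, ?l) # ps"] conjI hom) auto
  qed
  from this[of n] obtain ps where ps: "\<forall>(u, v)\<in>set ps. path u \<and> path_image u \<subseteq> S \<and>
      pathstart u = x \<and> (\<exists>U\<in>\<U>. v \<in> loops_at U (pathfinish u))"
    and hom: "homotopic_paths S ((\<gamma> \<circ> linepath 0 1) +++ (h \<circ> linepath 1 1))
        (conjugate_product x ps +++ h)"
    using t by auto
  have "\<gamma> \<circ> linepath 0 1 = \<gamma>" "h \<circ> linepath 1 1 = (\<lambda>_. pathfinish \<gamma>)"
    using eq[of n] t by (auto simp: fun_eq_iff linepath_def pathfinish_def)
  with hom have "homotopic_paths S (\<gamma> +++ (\<lambda>_. pathfinish \<gamma>)) (conjugate_product x ps +++ h)"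
    by simp
  then have "homotopic_paths S \<gamma> (conjugate_product x ps +++ h)"
    using homotopic_paths_trans[OF homotopic_paths_sym[OF homotopic_paths_const_right[OF \<gamma> refl]]]
    by blast
  with ps show ?thesis
    by blast
qed

section \<open>Comparison with the Spanier group\<close>

text \<open>
  A Lebesgue number of the preimages of the cover bounds the mesh. The preimages are only relatively
  open in \<open>[0, 1]\<close>, so they are replaced by open sets of reals whose trace on \<open>[0, 1]\<close> maps into a
  member of the cover.
\<close>

lemma path_partition_subordinate_to_cover:
  fixes h :: "real \<Rightarrow> 'a::topological_space"
  assumes h: "path h" "path_image h \<subseteq> S" and cover: "open_cover S \<U>"
  obtains n :: nat where "n > 0"
    and "\<And>i. i < n \<Longrightarrow> \<exists>U\<in>\<U>. h ` {real i / real n..real (Suc i) / real n} \<subseteq> U"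
proof -
  define \<G> where "\<G> = {G. open G \<and> (\<exists>U\<in>\<U>. h ` (G \<inter> {0..1}) \<subseteq> U)}"
  have "{0..1} \<subseteq> \<Union>\<G>"
  proof
    fix s :: real assume s: "s \<in> {0..1}"
    then have "h s \<in> S"
      using h by (auto simp: path_image_def)
    then obtain U where U: "U \<in> \<U>" "h s \<in> U" "openin (top_of_set S) U"
      using cover by (auto simp: open_cover_def)
    then obtain T where T: "open T" "U = S \<inter> T"
      by (auto simp: openin_open)
    obtain G where G: "open G" "G \<inter> {0..1} = h -` T \<inter> {0..1}"
      using h T(1) unfolding path_def continuous_on_open_invariant by blast
    have "h ` (G \<inter> {0..1}) \<subseteq> U"
      using G(2) T(2) h by (auto simp: path_image_def)
    with G(1) U(1) have "G \<in> \<G>"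
      by (auto simp: \<G>_def)
    moreover have "s \<in> G"
      using G(2) s T(2) U(2) by blast
    ultimately show "s \<in> \<Union>\<G>"
      by blast
  qed
  then obtain \<epsilon> where \<epsilon>: "0 < \<epsilon>" "\<And>s. s \<in> {0..1} \<Longrightarrow> \<exists>G\<in>\<G>. ball s \<epsilon> \<subseteq> G"
    by (rule Heine_Borel_lemma[OF compact_Icc]) (auto simp: \<G>_def)
  obtain n where n: "inverse (real (Suc n)) < \<epsilon>"
    using reals_Archimedean[OF \<epsilon>(1)] by blast
  show ?thesis
  proof (rule that[of "Suc n"])
    fix i assume i: "i < Suc n"
    let ?a = "real i / real (Suc n)" and ?b = "real (Suc i) / real (Suc n)"
    have a: "0 \<le> ?a" "?a \<le> 1"
      using i by (auto simp: divide_simps)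
    have "?b = ?a + inverse (real (Suc n))"
      by (simp add: field_simps)
    with n have "?b < ?a + \<epsilon>"
      by linarith
    moreover have "?b \<le> 1"
      using i by (simp add: divide_le_eq)
    ultimately have b: "?b \<le> 1" "?b < ?a + \<epsilon>"
      by auto
    obtain G where "G \<in> \<G>" "ball ?a \<epsilon> \<subseteq> G"
      using \<epsilon>(2)[of ?a] a by auto
    moreover have "{?a..?b} \<subseteq> ball ?a \<epsilon> \<inter> {0..1}"
    proof
      fix y assume "y \<in> {?a..?b}"
      then have "?a \<le> y" "y \<le> ?b" by auto
      with a(1) b show "y \<in> ball ?a \<epsilon> \<inter> {0..1}"
        unfolding IntI mem_ball dist_real_def Int_iff atLeastAtMost_iff by linarith
    qed
    ultimately show "\<exists>U\<in>\<U>. h ` {?a..?b} \<subseteq> U"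
      unfolding \<G>_def by blast
  qed simp
qed

lemma qs_group_subset_spanier_group:
  "qs_group S x \<subseteq> spanier_group S x"
proof
  fix a assume "a \<in> qs_group S x"
  then obtain f h where f: "f \<in> loops_at S x" "a = path_class S f"
    and h: "h \<in> loops_at S x" "path_class S h = path_class S (\<lambda>_. x)"
    and close: "homotopically_close S f h"
    by (auto simp: qs_group_def qs_closure_def)
  have hp: "path h" "path_image h \<subseteq> S" "pathstart h = x" "pathfinish h = x"
    using h by (auto simp: loops_at_def)
  have hx: "homotopic_paths S h (\<lambda>_. x)"
    using h(2) path_class_eq_iff[OF hp(1,2)] by simp
  have "a \<in> spanier_cover_group S \<U> x" if cover: "open_cover S \<U>" for \<U>
  proof -
    obtain n :: nat where n: "n > 0"
      and hU: "\<And>i. i < n \<Longrightarrow> \<exists>U\<in>\<U>. h ` {real i / real n..real (Suc i) / real n} \<subseteq> U"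
      using path_partition_subordinate_to_cover[OF hp(1,2) cover] by blast
    define t where "t i = real i / real n" for i
    from hU obtain V where V: "\<And>i. i < n \<Longrightarrow> V i \<in> \<U>"
      "\<And>i. i < n \<Longrightarrow> h ` {t i..t (Suc i)} \<subseteq> V i"
      unfolding t_def by metis
    have t: "t 0 = 0" "t n = 1" "\<And>i. t i < t (Suc i)"
      using n by (auto simp: t_def divide_strict_right_mono)
    \<comment> \<open>closeness numbers the members of the cover from \<open>1\<close>\<close>
    have "\<forall>i\<in>{1..n}. openin (top_of_set S) (V (i - 1)) \<and> h ` {t (i - 1)..t i} \<subseteq> V (i - 1)"
    proof
      fix i assume "i \<in> {1..n}"
      then have "i - 1 < n" "Suc (i - 1) = i" by auto
      then show "openin (top_of_set S) (V (i - 1)) \<and> h ` {t (i - 1)..t i} \<subseteq> V (i - 1)"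
        using V[of "i - 1"] cover by (auto simp: open_cover_def)
    qed
    moreover have "\<forall>i\<in>{1..n}. t (i - 1) < t i"
    proof
      fix i assume "i \<in> {1..n}"
      then show "t (i - 1) < t i" using t(3)[of "i - 1"] by simp
    qed
    ultimately obtain \<gamma> where \<gamma>: "path \<gamma>" "path_image \<gamma> \<subseteq> S"
      and \<gamma>V: "\<forall>i\<in>{1..n}. \<gamma> ` {t (i - 1)..t i} \<subseteq> V (i - 1)"
      and \<gamma>t: "\<forall>i\<in>{0..n}. \<gamma> (t i) = h (t i)"
      and \<gamma>f: "homotopic_paths S \<gamma> f"
      using homotopically_close_approximation[OF close t(1,2), of "\<lambda>i. V (i - 1)"] by metis
    have "\<exists>U\<in>\<U>. \<gamma> ` {t i..t (Suc i)} \<subseteq> U \<and> h ` {t i..t (Suc i)} \<subseteq> U" if "i < n" for i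
      using bspec[OF \<gamma>V, of "Suc i"] V[OF that] that by auto
    then obtain ps where ps: "\<forall>(u, v)\<in>set ps. path u \<and> path_image u \<subseteq> S \<and> pathstart u = x \<and>
          (\<exists>U\<in>\<U>. v \<in> loops_at U (pathfinish u))"
      and \<gamma>ps: "homotopic_paths S \<gamma> (conjugate_product x ps +++ h)"
      using piecewise_close_paths_differ_by_conjugates[OF \<gamma> hp(1,2) t, of \<U> x] \<gamma>t hp(3) by force
    let ?c = "conjugate_product x ps"
    have fin: "pathfinish ?c = x"
      by (induction ps) (auto simp: pathfinish_def joinpaths_def)
    have "path (?c +++ h)" "path_image (?c +++ h) \<subseteq> S"
      using homotopic_paths_imp_path[OF \<gamma>ps] homotopic_paths_imp_subset[OF \<gamma>ps] by auto
    then have c: "path ?c" "path_image ?c \<subseteq> S"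
      using fin hp(3) by (auto simp: path_image_join)
    have "homotopic_paths S f (?c +++ h)"
      using homotopic_paths_trans[OF homotopic_paths_sym[OF \<gamma>f] \<gamma>ps] .
    also have "homotopic_paths S \<dots> (?c +++ (\<lambda>_. x))"
      using c fin hp hx by (intro homotopic_paths_join) auto
    also have "homotopic_paths S \<dots> ?c"
      using c fin by (intro homotopic_paths_const_right) auto
    finally have "a = path_class S ?c"
      using f(2) path_class_eqI by simp
    with ps show ?thesis
      unfolding spanier_cover_group_def by blast
  qed
  then show "a \<in> spanier_group S x"
    by (auto simp: spanier_group_def)
qed

section \<open>Closure of subgroups\<close>

lemma qs_closure_subset_subgroup:
  assumes K: "subgroup K (fundamental_group S x)" and qs: "qs_group S x \<subseteq> K"
    and HK: "H \<subseteq> K"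
  shows "qs_closure S x H \<subseteq> K"
proof
  let ?G = "fundamental_group S x"
  fix a assume "a \<in> qs_closure S x H"
  then obtain f h where f: "f \<in> loops_at S x" "a = path_class S f"
    and h: "h \<in> loops_at S x" "path_class S h \<in> H" and close: "homotopically_close S f h"
    by (auto simp: qs_closure_def)
  have fh: "path f" "path_image f \<subseteq> S" "path h" "path_image h \<subseteq> S"
    "pathstart f = x" "pathfinish f = x" "pathstart h = x" "pathfinish h = x"
    using f h by (auto simp: loops_at_def)
  let ?q = "f +++ reversepath h"
  have q: "?q \<in> loops_at S x"
    by (intro loops_at_join loops_at_reverse f h)
  have "path_class S ?q \<in> K"
    using homotopically_close_imp_mult_inv_in_qs_group[OF f(1) h(1) close] qs by blast
  moreover have "path_class S h \<in> K"
    using h HK by blast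
  ultimately have "path_class S (?q +++ h) \<in> K"
    using subgroup.m_closed[OF K] mult_path_class[OF q h(1)] by metis
  moreover have "homotopic_paths S (?q +++ h) f"
  proof -
    have "homotopic_paths S (?q +++ h) (f +++ (reversepath h +++ h))"
      using fh by (intro homotopic_paths_sym[OF homotopic_paths_assoc]) auto
    also have "homotopic_paths S \<dots> (f +++ (\<lambda>_. x))"
      using fh homotopic_paths_reverse_right[of "reversepath h" S x]
      by (intro homotopic_paths_join) auto
    also have "homotopic_paths S \<dots> f"
      using fh by (intro homotopic_paths_const_right) auto
    finally show ?thesis .
  qed
  ultimately show "a \<in> K"
    using f(2) path_class_eqI by metis
qed

theorem corollary3p4:
  fixes S :: "'a::topological_space set" and x :: 'a
    and H K :: "(real \<Rightarrow> 'a) set set"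
  assumes "path_connected S" and "x \<in> S"
    and "H \<subseteq> carrier (fundamental_group S x)"
    and "subgroup K (fundamental_group S x)"
    and "qs_group S x \<subseteq> K \<or> spanier_group S x \<subseteq> K"
  shows "(H \<subseteq> K \<longleftrightarrow> qs_closure S x H \<subseteq> K) \<and> qs_closure S x K = K"
proof -
  have "qs_group S x \<subseteq> K"
    using assms(5) qs_group_subset_spanier_group by blast
  note closure = qs_closure_subset_subgroup[OF assms(4) this]
  have "K \<subseteq> qs_closure S x K"
    using assms(4) by (intro subset_qs_closure subgroup.subset)
  then show ?thesis
    using closure[of H] closure[of K] subset_qs_closure[OF assms(3)] by blast
qed

end
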